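(* Let $d\in\mathbb{N}$ and, for every $i\in\{1,\dots,d\}$, let $n_i>0$ be a real number, let $h_i:\mathbb{R}^d\to\mathbb{R}$ be locally Lipschitz continuous and bounded, and let $p_i:\mathbb{R}\to\mathbb{R}$ be continuous and $2\pi$-periodic. Consider the system $$x_i''+n_i^2x_i+h_i(x)=p_i(t),\qquad i=1,\dots,d,\qquad x=(x_1,\dots,x_d).$$ Assume that for some $j\in\{1,\dots,d\}$ one has $$n_j\in\mathbb{N}\qquad\text{and}\qquad 2\left(\sup_{\mathbb{R}^d}h_j-\inf_{\mathbb{R}^d}h_j\right)<\left|\int_0^{2\pi}p_j(t)e^{\mathrm{i}n_jt}\,dt\right|.$$ Then, for that $j$ and for every solution $x:\mathbb{R}\to\mathbb{R}^d$ of the system, $$\lim_{|t|\to+\infty}\left(x_j(t)^2+x_j'(t)^2\right)=+\infty.$$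
   Context: $\mathbb{N}=\{1,2,3,\dots\}$, and $|\cdot|$ applied to a complex number is its modulus. Since the $h_i$ are locally Lipschitz and bounded and the $p_i$ are continuous, every solution of the system is defined on all of $\mathbb{R}$. *)

theory Defs
  imports "HOL-Analysis.Analysis"
begin

definition is_solution ::
  "('d::finite \<Rightarrow> real) \<Rightarrow> ('d \<Rightarrow> real ^ 'd \<Rightarrow> real) \<Rightarrow> ('d \<Rightarrow> real \<Rightarrow> real) \<Rightarrow> (real \<Rightarrow> real ^ 'd) \<Rightarrow> bool"
  where "is_solution n h p x \<longleftrightarrow>
    (\<forall>i t. (\<lambda>s. x s $ i) differentiable (at t) \<and>
           deriv (\<lambda>s. x s $ i) differentiable (at t) \<and>
           deriv (deriv (\<lambda>s. x s $ i)) t + (n i)\<^sup>2 * x t $ i + h i (x t) = p i t)"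

text \<open>The library's \<^const>\<open>local_lipschitz\<close> is about functions with a time parameter; here that
  parameter is a dummy.\<close>

definition locally_lipschitz :: "('a::metric_space \<Rightarrow> 'b::metric_space) \<Rightarrow> bool"
  where "locally_lipschitz f \<longleftrightarrow> local_lipschitz (UNIV :: real set) UNIV (\<lambda>_. f)"

end

theory Submission
  imports Defs
begin

text \<open>Write \<open>y\<close> for the resonant component, \<open>N\<close> for its integer frequency and \<open>g\<close> for the value of
  its bounded nonlinearity along the solution, so that \<open>y'' + N\<^sup>2 y = p - g\<close>. By variation of
  constants, \<open>e\<^bsup>\<i>Nt\<^esup> (y' - \<i>Ny)\<close> has derivative \<open>e\<^bsup>\<i>Nt\<^esup> (p - g)\<close>. Rotate by the phase \<open>\<theta>\<close> that makes
  the \<open>N\<close>-th Fourier integral of \<open>p\<close> equal to its modulus and take real parts: the function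
  \<open>W = cos (Nt + \<theta>) y' + N sin (Nt + \<theta>) y\<close> has derivative \<open>cos (Nt + \<theta>) (p - g)\<close>.

  Over one period, the forcing contributes the modulus of the Fourier integral to the increase of
  \<open>W\<close>. Since the mean of the cosine is zero, only the oscillation of \<open>g\<close> about the midpoint of its
  range \<open>[a, b]\<close> counts against this, and it costs at most \<open>(b - a) / 2\<close> times the integral of
  \<open>\<bar>cos (Nt + \<theta>)\<bar>\<close>, which is \<open>4\<close>. So \<open>W\<close> gains at least a fixed positive amount in every period,
  tends to \<open>\<plusminus>\<infinity>\<close> as \<open>t \<rightarrow> \<plusminus>\<infinity>\<close>, and \<open>W\<^sup>2 \<le> N\<^sup>2 (y\<^sup>2 + y'\<^sup>2)\<close> by the Cauchy-Schwarz inequality.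

  The estimate is carried out with antiderivatives: \<open>W\<close> is compared with an explicit function \<open>B\<close>
  that satisfies \<open>B' \<le> W'\<close> and gains the same positive amount in every period, so that \<open>g\<close> is never
  integrated. The argument for a single oscillator is \<open>resonant_oscillator_unbounded\<close>; the limits of
  \<open>B\<close> come from \<open>quasiperiodic_at_top\<close> and \<open>quasiperiodic_at_bot\<close>, and the integral of the modulus
  of the cosine from \<open>antiderivative_abs_cos_shift\<close>.\<close>

section \<open>Functions that gain a constant in every period\<close>

lemma antiderivative_periodic_shift:
  fixes F f :: "real \<Rightarrow> real"
  assumes F: "\<And>t. (F has_real_derivative f t) (at t)"
    and per: "\<And>t. f (t + T) = f t"
  shows "F (t + T) - F t = F (s + T) - F s"
proof -
  have "((\<lambda>t. F (t + T) - F t) has_real_derivative 0) (at t)" for t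
    using DERIV_diff[OF F[of "t + T", unfolded DERIV_shift] F[of t]] by (simp add: per)
  then show ?thesis
    using DERIV_isconst_all[of "\<lambda>t. F (t + T) - F t"] by blast
qed

lemma shift_iterate:
  fixes F :: "real \<Rightarrow> real"
  assumes "\<And>t. F (t + T) = F t + \<delta>"
  shows "F (t + real k * T) = F t + real k * \<delta>"
proof (induction k)
  case (Suc k)
  then show ?case
    using assms[of "t + real k * T"] by (simp add: algebra_simps)
qed simp

text \<open>The linear function of slope \<open>\<delta> / T\<close> differs from \<open>F\<close> by a continuous periodic, hence bounded,
  function.\<close>

lemma quasiperiodic_at_top:
  fixes F :: "real \<Rightarrow> real"
  assumes cont: "continuous_on UNIV F"
    and shift: "\<And>t. F (t + T) = F t + \<delta>"
    and "T > 0" "\<delta> > 0"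
  shows "filterlim F at_top at_top"
proof -
  have "bounded (F ` {0..T})"
    by (intro compact_imp_bounded compact_continuous_image continuous_on_subset[OF cont]) auto
  then obtain C where C: "\<And>s. 0 \<le> s \<Longrightarrow> s \<le> T \<Longrightarrow> \<bar>F s\<bar> \<le> C"
    unfolding bounded_iff by force
  have lower: "(\<delta> / T) * t - \<delta> - C \<le> F t" if "t \<ge> 0" for t
  proof -
    define k where "k = nat \<lfloor>t / T\<rfloor>"
    have k: "real k \<le> t / T" "t / T < real k + 1"
      using that \<open>T > 0\<close> by (auto simp: k_def)
    then have rem: "0 \<le> t - real k * T" "t - real k * T \<le> T"
      using \<open>T > 0\<close> by (auto simp: field_simps)
    have "F t = F (t - real k * T) + real k * \<delta>"
      using shift_iterate[of F T \<delta> "t - real k * T" k, OF shift] by simp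
    moreover have "\<delta> * (t / T) \<le> \<delta> * (real k + 1)"
      using k \<open>\<delta> > 0\<close> by (intro mult_left_mono) auto
    ultimately show ?thesis
      using C[OF rem] by (simp add: algebra_simps)
  qed
  have "filterlim (\<lambda>t. (- \<delta> - C) + (\<delta> / T) * t) at_top at_top"
    using \<open>T > 0\<close> \<open>\<delta> > 0\<close>
    by (intro filterlim_tendsto_add_at_top[OF tendsto_const]
        filterlim_tendsto_pos_mult_at_top[OF tendsto_const _ filterlim_ident]) simp
  then show ?thesis
  proof (rule filterlim_at_top_mono)
    show "\<forall>\<^sub>F t in at_top. (- \<delta> - C) + (\<delta> / T) * t \<le> F t"
      using eventually_ge_at_top[of 0] by eventually_elim (use lower in force)
  qed
qed

lemma quasiperiodic_at_bot:
  fixes F :: "real \<Rightarrow> real"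
  assumes cont: "continuous_on UNIV F"
    and shift: "\<And>t. F (t + T) = F t + \<delta>"
    and "T > 0" "\<delta> > 0"
  shows "filterlim F at_bot at_bot"
proof -
  have "filterlim (\<lambda>t. - F (- t)) at_top at_top"
  proof (rule quasiperiodic_at_top)
    show "continuous_on UNIV (\<lambda>t. - F (- t))"
      by (intro continuous_intros continuous_on_compose2[OF cont]) auto
    show "- F (- (t + T)) = - F (- t) + \<delta>" for t
      using shift[of "- t - T"] by simp
  qed fact+
  then show ?thesis
    by (simp add: filterlim_at_bot_mirror filterlim_uminus_at_bot)
qed

section \<open>Antiderivatives on the real line\<close>

text \<open>By periodicity it suffices to look at the shift from \<open>-\<pi>/2\<close> to \<open>\<pi>/2\<close>, where the cosine is
  nonnegative and the sine is another antiderivative.\<close>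

lemma antiderivative_abs_cos_shift:
  fixes F :: "real \<Rightarrow> real"
  assumes F: "\<And>t. (F has_real_derivative \<bar>cos t\<bar>) (at t)"
  shows "F (t + pi) = F t + 2"
proof -
  have "F (t + pi) - F t = F (- (pi / 2) + pi) - F (- (pi / 2))"
    by (rule antiderivative_periodic_shift[OF F]) simp
  also have "\<dots> = F (pi / 2) - F (- (pi / 2))"
    by simp
  also have "\<dots> = 2"
  proof -
    have "F (pi / 2) - sin (pi / 2) = F (- (pi / 2)) - sin (- (pi / 2))"
    proof (rule DERIV_isconst2[where f = "\<lambda>t. F t - sin t"])
      show "continuous_on {- (pi / 2)..pi / 2} (\<lambda>t. F t - sin t)"
        by (intro continuous_on_diff continuous_on_sin continuous_on_id
            DERIV_continuous_on[OF has_field_derivative_at_within[OF F]])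
      show "((\<lambda>t. F t - sin t) has_real_derivative 0) (at s)"
        if "- (pi / 2) < s" "s < pi / 2" for s
        using DERIV_diff[OF F[of s] DERIV_sin[of s]] cos_gt_zero_pi[of s] that by simp
    qed auto
    then show ?thesis
      by simp
  qed
  finally show ?thesis
    by simp
qed

lemma ex_antiderivative:
  fixes f :: "real \<Rightarrow> real"
  assumes "continuous_on UNIV f"
  obtains F where "\<And>t. (F has_real_derivative f t) (at t)"
  using einterval_antiderivative[of "-\<infinity>" "\<infinity>" f] assms
  by (auto simp: continuous_on_eq_continuous_at has_real_derivative_iff_has_vector_derivative)

section \<open>A forced oscillator at resonance\<close>

text \<open>In every period the forcing pushes one coordinate of the rotating phase plane further than \<open>g\<close>
  can push it back. Only the values of the nonlinearity along the solution enter, through the bounds \<open>a\<close> and \<open>b\<close>, so the coupling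
  to the other components of a system is hidden in \<open>g\<close>.\<close>

lemma resonant_oscillator_unbounded:
  fixes y v g p :: "real \<Rightarrow> real" and N :: nat and a b :: real
  assumes "N > 0"
    and y: "\<And>t. (y has_real_derivative v t) (at t)"
    and v: "\<And>t. (v has_real_derivative p t - g t - (real N)\<^sup>2 * y t) (at t)"
    and g: "\<And>t. a \<le> g t" "\<And>t. g t \<le> b"
    and cont: "continuous_on UNIV p"
    and per: "\<And>t. p (t + 2 * pi) = p t"
    and gap: "2 * (b - a) <
      cmod (integral {0..2 * pi} (\<lambda>t. complex_of_real (p t) * exp (\<i> * complex_of_real (real N * t))))"
      (is "_ < cmod (integral _ ?f)")
  shows "filterlim (\<lambda>t. (y t)\<^sup>2 + (v t)\<^sup>2) at_top at_infinity"
proof -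
  define P where "P = integral {0..2 * pi} ?f"
  define \<theta> where "\<theta> = - Arg P"
  define c where "c = (\<lambda>t. cos (real N * t + \<theta>))"
  define W where "W = (\<lambda>t. c t * v t + real N * sin (real N * t + \<theta>) * y t)"
  have c_cont: "continuous_on UNIV c"
    unfolding c_def by (intro continuous_intros)
  have sc_shift: "sin (real N * (t + 2 * pi) + \<theta>) = sin (real N * t + \<theta>)"
    "c (t + 2 * pi) = c t" for t
    using sin.plus_of_nat[of "real N * t + \<theta>" N] cos.plus_of_nat[of "real N * t + \<theta>" N]
    by (simp_all add: c_def algebra_simps)
  have W: "(W has_real_derivative c t * (p t - g t)) (at t)" for t
    unfolding W_def c_def
    by (rule derivative_eq_intros refl y v)+ (simp add: algebra_simps power2_eq_square)

  \<comment> \<open>The forcing term: its antiderivative gains the modulus of \<open>P\<close> per period.\<close>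
  obtain Q where Q: "\<And>t. (Q has_real_derivative c t * p t) (at t)"
    using ex_antiderivative[of "\<lambda>t. c t * p t"] c_cont cont continuous_on_mult by blast
  have Q_shift: "Q (t + 2 * pi) = Q t + cmod P" for t
  proof -
    have "?f integrable_on {0..2 * pi}"
      by (intro integrable_continuous_interval continuous_intros continuous_on_subset[OF cont]) auto
    then have "((\<lambda>t. Re (cis \<theta> * ?f t)) has_integral Re (cis \<theta> * P)) {0..2 * pi}"
      unfolding P_def by (intro has_integral_Re has_integral_mult_right integrable_integral)
    moreover have "Re (cis \<theta> * ?f t) = c t * p t" for t
      by (simp add: c_def Re_exp Im_exp cos_add algebra_simps)
    moreover have "cis \<theta> * P = cmod P"
    proof -
      have "cis \<theta> * P = cis \<theta> * (cmod P * cis (Arg P))"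
        by (metis rcis_cmod_Arg rcis_def)
      then show ?thesis
        by (simp add: \<theta>_def cis_mult mult.left_commute)
    qed
    ultimately have "((\<lambda>t. c t * p t) has_integral cmod P) {0..2 * pi}"
      by simp
    moreover have "((\<lambda>t. c t * p t) has_integral Q (2 * pi) - Q 0) {0..2 * pi}"
      by (rule fundamental_theorem_of_calculus)
        (auto intro: has_field_derivative_at_within[OF Q] simp: has_real_derivative_iff_has_vector_derivative[symmetric])
    ultimately have "Q (0 + 2 * pi) - Q 0 = cmod P"
      by (simp add: has_integral_unique)
    moreover have "Q (t + 2 * pi) - Q t = Q (0 + 2 * pi) - Q 0"
      by (rule antiderivative_periodic_shift[OF Q]) (simp add: sc_shift per)
    ultimately show ?thesis
      by simp
  qed

  \<comment> \<open>The period \<open>2 \<pi>\<close> comprises \<open>2 N\<close> half-waves of the cosine, each of area \<open>2 / N\<close>.\<close>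
  obtain A\<^sub>0 where A\<^sub>0: "\<And>t. (A\<^sub>0 has_real_derivative \<bar>cos t\<bar>) (at t)"
    by (rule ex_antiderivative[of "\<lambda>t. \<bar>cos t\<bar>"]) (intro continuous_intros, blast)
  define A where "A = (\<lambda>t. A\<^sub>0 (real N * t + \<theta>) / real N)"
  have A: "(A has_real_derivative \<bar>c t\<bar>) (at t)" for t
  proof -
    have "((\<lambda>t. A\<^sub>0 (real N * t + \<theta>)) has_real_derivative \<bar>cos (real N * t + \<theta>)\<bar> * real N) (at t)"
      by (rule DERIV_chain2[OF A\<^sub>0]) (auto intro!: derivative_eq_intros)
    from DERIV_cdivide[OF this, of "real N"] show ?thesis
      using \<open>N > 0\<close> by (simp add: A_def c_def)
  qed
  have A_shift: "A (t + 2 * pi) = A t + 4" for t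
  proof -
    have "A\<^sub>0 ((real N * t + \<theta>) + real (2 * N) * pi) = A\<^sub>0 (real N * t + \<theta>) + real (2 * N) * 2"
      by (rule shift_iterate) (rule antiderivative_abs_cos_shift[OF A\<^sub>0])
    moreover have "real N * (t + 2 * pi) + \<theta> = (real N * t + \<theta>) + real (2 * N) * pi"
      by (simp add: algebra_simps)
    ultimately show ?thesis
      using \<open>N > 0\<close> by (simp add: A_def field_simps)
  qed

  \<comment> \<open>The derivative of \<open>B\<close> is the smallest value of \<open>c t * (p t - r)\<close> for \<open>r\<close> between \<open>a\<close> and \<open>b\<close>.\<close>
  define B where
    "B = (\<lambda>t. Q t - (a + b) / 2 * (sin (real N * t + \<theta>) / real N) - (b - a) / 2 * A t)"
  have B: "(B has_real_derivative c t * p t - (a + b) / 2 * c t - (b - a) / 2 * \<bar>c t\<bar>) (at t)" for t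
    unfolding B_def using \<open>N > 0\<close>
    by (auto intro!: derivative_eq_intros Q A simp: c_def)
  have B_shift: "B (t + 2 * pi) = B t + (cmod P - 2 * (b - a))" for t
    by (simp add: B_def Q_shift A_shift sc_shift) (simp add: field_simps)
  have B_cont: "continuous_on UNIV B"
    by (rule DERIV_continuous_on[OF has_field_derivative_at_within[OF B]])
  have drift: "0 < cmod P - 2 * (b - a)"
    using gap by (simp add: P_def)
  have B_top: "filterlim B at_top at_top" and B_bot: "filterlim B at_bot at_bot"
    using quasiperiodic_at_top[OF B_cont B_shift _ drift]
      quasiperiodic_at_bot[OF B_cont B_shift _ drift] by simp_all

  have mono: "W s - B s \<le> W t - B t" if "s \<le> t" for s t
  proof (rule DERIV_nonneg_imp_nondecreasing[OF that], intro exI conjI)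
    fix r
    show "((\<lambda>t. W t - B t) has_real_derivative
        c r * (p r - g r) - (c r * p r - (a + b) / 2 * c r - (b - a) / 2 * \<bar>c r\<bar>)) (at r)"
      by (rule DERIV_diff[OF W B])
    have "c r * (g r - (a + b) / 2) \<le> \<bar>c r\<bar> * \<bar>g r - (a + b) / 2\<bar>"
      by (metis abs_ge_self abs_mult)
    also have "\<dots> \<le> \<bar>c r\<bar> * ((b - a) / 2)"
      using g(1)[of r] g(2)[of r] by (intro mult_left_mono) (auto simp: abs_le_iff field_simps)
    finally show "0 \<le> c r * (p r - g r) - (c r * p r - (a + b) / 2 * c r - (b - a) / 2 * \<bar>c r\<bar>)"
      by (simp add: field_simps)
  qed

  have W_top: "filterlim W at_top at_top"
  proof (rule filterlim_at_top_mono)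
    show "filterlim (\<lambda>t. (W 0 - B 0) + B t) at_top at_top"
      by (rule filterlim_tendsto_add_at_top[OF tendsto_const B_top])
    show "\<forall>\<^sub>F t in at_top. (W 0 - B 0) + B t \<le> W t"
      using eventually_ge_at_top[of 0] by eventually_elim (use mono[of 0] in fastforce)
  qed
  have W_bot: "filterlim (\<lambda>t. - W t) at_top at_bot"
  proof (rule filterlim_at_top_mono)
    show "filterlim (\<lambda>t. (B 0 - W 0) + - B t) at_top at_bot"
      using B_bot by (intro filterlim_tendsto_add_at_top[OF tendsto_const])
        (simp add: filterlim_uminus_at_bot)
    show "\<forall>\<^sub>F t in at_bot. (B 0 - W 0) + - B t \<le> - W t"
      using eventually_le_at_bot[of 0] by eventually_elim (use mono[of _ 0] in fastforce)
  qed

  \<comment> \<open>\<open>W t\<close> is one coordinate of the vector \<open>(v t, N y t)\<close> after a rotation.\<close>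
  have bound: "(1 / (real N)\<^sup>2) * (W t)\<^sup>2 \<le> (y t)\<^sup>2 + (v t)\<^sup>2" for t
  proof -
    define \<phi> where "\<phi> = real N * t + \<theta>"
    have "(cos \<phi> * v t + sin \<phi> * (real N * y t))\<^sup>2
        + (sin \<phi> * v t - cos \<phi> * (real N * y t))\<^sup>2
      = ((sin \<phi>)\<^sup>2 + (cos \<phi>)\<^sup>2) * ((v t)\<^sup>2 + (real N * y t)\<^sup>2)"
      by algebra
    then have "(cos \<phi> * v t + sin \<phi> * (real N * y t))\<^sup>2 \<le> (v t)\<^sup>2 + (real N * y t)\<^sup>2"
      using zero_le_power2[of "sin \<phi> * v t - cos \<phi> * (real N * y t)"]
      unfolding sin_cos_squared_add mult_1 by (metis le_add_same_cancel1)
    then have "(W t)\<^sup>2 \<le> (v t)\<^sup>2 + (real N * y t)\<^sup>2"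
      by (simp add: W_def c_def \<phi>_def mult_ac)
    also have "\<dots> \<le> (real N)\<^sup>2 * ((y t)\<^sup>2 + (v t)\<^sup>2)"
      using \<open>N > 0\<close> mult_right_mono[of 1 "(real N)\<^sup>2" "(v t)\<^sup>2"]
      by (simp add: algebra_simps power_mult_distrib)
    finally show ?thesis
      using \<open>N > 0\<close> by (simp add: field_simps)
  qed
  have conv: "filterlim (\<lambda>t. (y t)\<^sup>2 + (v t)\<^sup>2) at_top F"
    if "filterlim (\<lambda>t. (W t)\<^sup>2) at_top F" for F
    using \<open>N > 0\<close>
    by (intro filterlim_at_top_mono[OF filterlim_tendsto_pos_mult_at_top[OF tendsto_const _ that]])
      (auto intro: bound always_eventually)
  have "filterlim (\<lambda>t. (W t)\<^sup>2) at_top at_top" "filterlim (\<lambda>t. (W t)\<^sup>2) at_top at_bot"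
    using filterlim_pow_at_top[OF _ W_top, of 2] filterlim_pow_at_top[OF _ W_bot, of 2] by simp_all
  then show ?thesis
    unfolding at_infinity_eq_at_top_bot by (intro filterlim_sup conv)
qed

section \<open>Unboundedness of the resonant component\<close>

theorem theorem2p1:
  fixes n :: "'d::finite \<Rightarrow> real"
    and h :: "'d \<Rightarrow> real ^ 'd \<Rightarrow> real"
    and p :: "'d \<Rightarrow> real \<Rightarrow> real"
    and j :: 'd
    and x :: "real \<Rightarrow> real ^ 'd"
  assumes "\<And>i. n i > 0"
    and "\<And>i. locally_lipschitz (h i)"
    and "\<And>i. bounded (range (h i))"
    and "\<And>i. continuous_on UNIV (p i)"
    and "\<And>i t. p i (t + 2 * pi) = p i t"
    and "n j \<in> \<nat>"
    and "2 * ((SUP y. h j y) - (INF y. h j y))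
           < cmod (integral {0..2 * pi} (\<lambda>t. complex_of_real (p j t) * exp (\<i> * complex_of_real (n j * t))))"
    and "is_solution n h p x"
  shows "filterlim (\<lambda>t. (x t $ j)\<^sup>2 + (deriv (\<lambda>s. x s $ j) t)\<^sup>2) at_top at_infinity"
proof -
  obtain N where N: "n j = real N"
    using \<open>n j \<in> \<nat>\<close> by (auto elim: Nats_cases)
  let ?y = "\<lambda>s. x s $ j"
  have sol: "?y differentiable (at t)" "deriv ?y differentiable (at t)"
    "deriv (deriv ?y) t + (n j)\<^sup>2 * x t $ j + h j (x t) = p j t" for t
    using \<open>is_solution n h p x\<close> unfolding is_solution_def by auto
  have bdd: "bdd_below (range (h j))" "bdd_above (range (h j))"
    using assms(3) bounded_imp_bdd_below bounded_imp_bdd_above by auto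
  show ?thesis
  proof (rule resonant_oscillator_unbounded)
    show "N > 0"
      using assms(1)[of j] N by simp
    show "(?y has_real_derivative deriv ?y t) (at t)" for t
      using sol(1)[of t] by (simp add: DERIV_deriv_iff_real_differentiable)
    have "deriv (deriv ?y) t = p j t - h j (x t) - (real N)\<^sup>2 * x t $ j" for t
      using sol(3)[of t] by (simp add: N)
    then show "(deriv ?y has_real_derivative p j t - h j (x t) - (real N)\<^sup>2 * x t $ j) (at t)" for t
      using sol(2)[of t] by (metis DERIV_deriv_iff_real_differentiable)
    show "(INF y. h j y) \<le> h j (x t)" "h j (x t) \<le> (SUP y. h j y)" for t
      using bdd by (auto intro: cINF_lower cSUP_upper)
  qed (use assms N in auto)
qed

end
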